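(* Let $b \geq 2$ and $s \geq 2$ be integers and let $m \geq 2s^s(s-1)^s$ be an integer. Then there is a set $\Gamma \subseteq [0,1)^s$ with the following two properties: (i) for every $\boldsymbol{x} \in [0,1)^s$ there exists $\boldsymbol{\gamma} \in \Gamma$ with \[ \| \boldsymbol{x} - \boldsymbol{\gamma} \| < b\sqrt{s}\, \frac{1}{b^{ \frac{m}{2(s-1)s}}}, \] where $\|\cdot\|$ is the Euclidean norm; (ii) if $\mathcal{P} = \{ \boldsymbol{x}_0, \ldots, \boldsymbol{x}_{b^m -1} \}$ is a $(0,m,s)$-net in base $b$ and $\boldsymbol{x}_i \in \Gamma$ for some $i \in \{ 0, \ldots, b^m-1 \}$, then, with $N=b^m$, \[ D^{*}(\mathcal{P}) \geq \frac{(b-1)^s(2s-3)^{s-1}}{b^s\,(4s^2(s-1)^2 \log b)^{s-1}}\, \frac{(\log N)^{s-1}}{N}. \]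
   Context: For integers $b \geq 2$, $s \geq 1$, $m \geq 0$, a $(0,m,s)$-net in base $b$ is a set of $b^m$ points in $[0,1)^s$ such that every interval of the form $\prod_{i=1}^s [a_i b^{-d_i}, (a_i+1) b^{-d_i})$ with $d_i \in \mathbb{N}_0$, $a_i \in \{0,\dots,b^{d_i}-1\}$ and volume $b^{-m}$ contains exactly one point of the set. For an $N$-point set $\mathcal{P} = \{\boldsymbol{x}_0,\dots,\boldsymbol{x}_{N-1}\}$ in $[0,1)^s$ and $\boldsymbol{y}=(y^{(1)},\dots,y^{(s)})$, let $\Delta(\boldsymbol{y},\mathcal{P}) = \sum_{n=0}^{N-1}\big(\chi_{[0,y^{(1)})\times\cdots\times[0,y^{(s)})}(\boldsymbol{x}_n) - y^{(1)}\cdots y^{(s)}\big)$; the star-discrepancy is $D^*(\mathcal{P}) = \sup_{\boldsymbol{y}\in[0,1)^s} |\Delta(\boldsymbol{y},\mathcal{P})|/N$. $\log$ is the natural logarithm. *)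

theory Defs
  imports "HOL-Analysis.Analysis"
begin

definition unit_cube :: "nat \<Rightarrow> (nat \<Rightarrow> real) set" where
  "unit_cube s = {x. (\<forall>i<s. 0 \<le> x i \<and> x i < 1) \<and> (\<forall>i\<ge>s. x i = 0)}"

definition eucl_dist :: "nat \<Rightarrow> (nat \<Rightarrow> real) \<Rightarrow> (nat \<Rightarrow> real) \<Rightarrow> real" where
  "eucl_dist s x y = sqrt (\<Sum>i<s. (x i - y i)^2)"

definition elem_box :: "nat \<Rightarrow> nat \<Rightarrow> (nat \<Rightarrow> nat) \<Rightarrow> (nat \<Rightarrow> nat) \<Rightarrow> (nat \<Rightarrow> real) set" where
  "elem_box b s d a = {x. \<forall>i<s. real (a i) / real b ^ d i \<le> x i \<and> x i < (real (a i) + 1) / real b ^ d i}"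

definition is_net :: "nat \<Rightarrow> nat \<Rightarrow> nat \<Rightarrow> (nat \<Rightarrow> nat \<Rightarrow> real) \<Rightarrow> bool" where
  "is_net b m s P \<longleftrightarrow> (\<forall>n<b^m. P n \<in> unit_cube s) \<and>
     (\<forall>d a. (\<Sum>i<s. d i) = m \<longrightarrow> (\<forall>i<s. a i < b ^ d i) \<longrightarrow>
        card {n. n < b^m \<and> P n \<in> elem_box b s d a} = 1)"

definition local_disc :: "nat \<Rightarrow> nat \<Rightarrow> (nat \<Rightarrow> nat \<Rightarrow> real) \<Rightarrow> (nat \<Rightarrow> real) \<Rightarrow> real" where
  "local_disc s N P y = (\<Sum>n<N. (if (\<forall>i<s. 0 \<le> P n i \<and> P n i < y i) then 1 else 0)
                                 - (\<Prod>i<s. y i))"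

definition star_disc :: "nat \<Rightarrow> nat \<Rightarrow> (nat \<Rightarrow> nat \<Rightarrow> real) \<Rightarrow> real" where
  "star_disc s N P = (SUP y\<in>unit_cube s. \<bar>local_disc s N P y\<bar> / real N)"

end

theory Submission
  imports Defs
begin

text \<open>
  Expand the \<open>i\<close>-th coordinate of \<open>\<gamma>\<close> in base \<open>b\<close> with \<open>L\<close> digits (positions counted from 0). Then
  \<open>[0, \<gamma>)\<close> is the disjoint union, over tuples \<open>J\<close> of positions, of boxes whose \<open>i\<close>-th side consists of
  the numbers agreeing with \<open>\<gamma>\<^sub>i\<close> before position \<open>J i\<close> and having a smaller digit there. If
  \<open>\<Sum>J + s \<le> m\<close>, the box is a union of elementary boxes of volume at least \<open>b\<^bsup>-m\<^esup>\<close> and contributes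
  nothing to the discrepancy function of a net. If \<open>\<Sum>J \<ge> m\<close> and \<open>\<gamma>\<close> itself belongs to the net, the box
  contains no net point, since such a point would share an elementary box of volume \<open>b\<^bsup>-m\<^esup>\<close> with \<open>\<gamma>\<close>;
  the contribution is then minus the scaled volume.

  Let the first \<open>A\<close> digits, \<open>A\<close> about \<open>m / (2 * s * (s - 1))\<close>, be arbitrary (this makes \<open>\<Gamma>\<close> dense), and let the
  others be \<open>b - 1\<close> on one residue class of positions modulo \<open>s\<close> and 0 elsewhere, the classes being such
  that \<open>\<Sum>J\<close> is congruent to \<open>m\<close>. With \<open>L\<close> about \<open>(m - A) / (s - 1)\<close>, a tuple that uses one of the arbitrary
  digits has \<open>\<Sum>J + s \<le> m\<close>, so the intermediate values of \<open>\<Sum>J\<close> never occur, all contributions have the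
  same sign, and the tuples with \<open>\<Sum>J = m\<close>, of which there are of order \<open>m ^ (s - 1)\<close>, contribute
  \<open>((b - 1) / b) ^ s\<close> each.
\<close>

section \<open>Truncated base-\<open>b\<close> expansions\<close>

primrec prefix_num :: "nat \<Rightarrow> (nat \<Rightarrow> nat) \<Rightarrow> nat \<Rightarrow> nat" where
  "prefix_num b c 0 = 0"
| "prefix_num b c (Suc j) = b * prefix_num b c j + c j"

definition trunc :: "nat \<Rightarrow> (nat \<Rightarrow> nat) \<Rightarrow> nat \<Rightarrow> real" where
  "trunc b c j = real (prefix_num b c j) / real b ^ j"

lemma trunc_0 [simp]: "trunc b c 0 = 0"
  by (simp add: trunc_def)

lemma trunc_Suc:
  assumes "b \<ge> 1"
  shows "trunc b c (Suc j) = trunc b c j + real (c j) / real b ^ Suc j"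
  using assms by (simp add: trunc_def field_simps)

lemma trunc_mono:
  assumes "b \<ge> 1" "j \<le> k"
  shows "trunc b c j \<le> trunc b c k"
  using assms(2) by (rule lift_Suc_mono_le[rotated]) (simp add: trunc_Suc[OF assms(1)])

text \<open>Replacing all digits from \<open>j\<close> on by at most \<open>b - 1\<close> cannot
  reach the next multiple of \<open>b^-j\<close>. Together with \<open>trunc_mono\<close> this says
  that the \<open>b\<close>-adic intervals of length \<open>b^-j\<close> starting at
  \<open>trunc b c j\<close> are nested.\<close>

lemma trunc_upper_antimono:
  assumes "b \<ge> 1" "\<And>j. c j < b" "j \<le> k"
  shows "trunc b c k + 1 / real b ^ k \<le> trunc b c j + 1 / real b ^ j"
proof (rule lift_Suc_antimono_le[OF _ assms(3)])
  fix n
  have "real (c n) + 1 \<le> real b"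
    using assms(2)[of n] by linarith
  then have "(real (c n) + 1) / real b ^ Suc n \<le> real b / real b ^ Suc n"
    by (rule divide_right_mono) simp
  then show "trunc b c (Suc n) + 1 / real b ^ Suc n \<le> trunc b c n + 1 / real b ^ n"
    using assms(1) by (simp add: trunc_Suc add_divide_distrib)
qed

lemma trunc_less:
  assumes "b \<ge> 1" "\<And>j. c j < b" "j \<le> k"
  shows "trunc b c k < trunc b c j + 1 / real b ^ j"
proof -
  have "0 < 1 / real b ^ k"
    using assms(1) by simp
  then show ?thesis
    using trunc_upper_antimono[of b c, OF assms] by linarith
qed

lemma prefix_num_less:
  assumes "\<And>j. c j < b"
  shows "prefix_num b c j < b ^ j"
proof (induction j)
  case (Suc j)
  have "prefix_num b c (Suc j) < b * (prefix_num b c j + 1)"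
    using assms[of j] by simp
  also have "\<dots> \<le> b * b ^ j"
    using Suc by (intro mult_le_mono2) simp
  finally show ?case
    by simp
qed simp

text \<open>The interval from 0 to \<open>trunc b c L\<close> is cut at the intermediate
  truncations; a digit 0 gives an empty piece.\<close>

lemma indicator_trunc_eq_sum:
  assumes "b \<ge> 1"
  shows "(if 0 \<le> x \<and> x < trunc b c L then 1 else 0 :: real) =
    (\<Sum>j<L. if trunc b c j \<le> x \<and> x < trunc b c (Suc j) then 1 else 0)"
proof (induction L)
  case (Suc L)
  show ?case
    using trunc_mono[OF assms, of 0 L c] trunc_mono[OF assms, of L "Suc L" c]
    by (simp flip: Suc)
qed simp

section \<open>Counting net points in boxes with \<open>b\<close>-adic corners\<close>

lemma mem_interval_iff_floor:
  fixes x :: real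
  assumes "b > 0" "0 \<le> x"
  shows "real a / real b ^ d \<le> x \<and> x < (real a + 1) / real b ^ d \<longleftrightarrow> a = nat \<lfloor>x * real b ^ d\<rfloor>"
proof -
  have "real a / real b ^ d \<le> x \<and> x < (real a + 1) / real b ^ d \<longleftrightarrow>
      real a \<le> x * real b ^ d \<and> x * real b ^ d < real a + 1"
    using assms by (simp add: field_simps)
  also have "\<dots> \<longleftrightarrow> \<lfloor>x * real b ^ d\<rfloor> = int a"
    by (simp add: floor_eq_iff)
  also have "\<dots> \<longleftrightarrow> a = nat \<lfloor>x * real b ^ d\<rfloor>"
    using assms by (auto simp: nat_eq_iff2)
  finally show ?thesis .
qed

text \<open>The box is a disjoint union of elementary boxes of volume \<open>b^-m\<close>, indexed
  by their integer corners, and each holds exactly one net point. The bound on \<open>q\<close>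
  keeps these cells inside the unit cube; if some \<open>q i \<le> p i\<close>, both sides are
  0.\<close>

lemma card_net_in_box:
  assumes net: "is_net b m s P" and b: "b > 0" and d: "(\<Sum>i<s. d i) = m"
    and q: "\<And>i. i < s \<Longrightarrow> q i \<le> b ^ d i"
  shows "card {n. n < b ^ m \<and> (\<forall>i<s. real (p i) / real b ^ d i \<le> P n i \<and> P n i < real (q i) / real b ^ d i)}
    = (\<Prod>i<s. q i - p i)"
    (is "card ?S = _")
proof -
  define F where "F = PiE {..<s} (\<lambda>i. {p i..<q i})"
  define cell where "cell a = {n. n < b ^ m \<and> P n \<in> elem_box b s d a}" for a
  have P: "0 \<le> P n i" if "n < b ^ m" "i < s" for n i
    using net that by (auto simp: is_net_def unit_cube_def)
  have cell: "n \<in> cell a \<longleftrightarrow> n < b ^ m \<and> (\<forall>i<s. a i = nat \<lfloor>P n i * real b ^ d i\<rfloor>)" for n a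
    unfolding cell_def elem_box_def using mem_interval_iff_floor[OF b P, of n] by blast
  have range: "real (p i) / real b ^ d i \<le> P n i \<and> P n i < real (q i) / real b ^ d i \<longleftrightarrow>
      nat \<lfloor>P n i * real b ^ d i\<rfloor> \<in> {p i..<q i}" if "n < b ^ m" "i < s" for n i
  proof -
    have "real (p i) / real b ^ d i \<le> P n i \<and> P n i < real (q i) / real b ^ d i \<longleftrightarrow>
        real (p i) \<le> P n i * real b ^ d i \<and> P n i * real b ^ d i < real (q i)"
      using b by (simp add: field_simps)
    also have "\<dots> \<longleftrightarrow> int (p i) \<le> \<lfloor>P n i * real b ^ d i\<rfloor> \<and> \<lfloor>P n i * real b ^ d i\<rfloor> < int (q i)"
      by (simp add: le_floor_iff floor_less_iff)
    also have "\<dots> \<longleftrightarrow> nat \<lfloor>P n i * real b ^ d i\<rfloor> \<in> {p i..<q i}"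
      using P[OF that] by (auto simp: le_nat_iff nat_less_iff)
    finally show ?thesis .
  qed
  have "?S = (\<Union>a\<in>F. cell a)"
  proof (intro equalityI subsetI)
    fix n assume "n \<in> ?S"
    then have "n \<in> cell (\<lambda>i\<in>{..<s}. nat \<lfloor>P n i * real b ^ d i\<rfloor>)"
      "(\<lambda>i\<in>{..<s}. nat \<lfloor>P n i * real b ^ d i\<rfloor>) \<in> F"
      using range[of n] by (auto simp: cell F_def)
    then show "n \<in> (\<Union>a\<in>F. cell a)"
      by blast
  next
    fix n assume "n \<in> (\<Union>a\<in>F. cell a)"
    then obtain a where a: "a \<in> F" "n \<in> cell a"
      by blast
    then have "nat \<lfloor>P n i * real b ^ d i\<rfloor> \<in> {p i..<q i}" if "i < s" for i
      using that by (auto simp: cell F_def PiE_iff)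
    then show "n \<in> ?S"
      using a range[of n] by (auto simp: cell)
  qed
  also have "card \<dots> = (\<Sum>a\<in>F. card (cell a))"
  proof (rule card_UN_disjoint)
    show "finite F"
      unfolding F_def by (intro finite_PiE) auto
    show "\<forall>a\<in>F. finite (cell a)"
      by (simp add: cell_def)
    show "\<forall>a\<in>F. \<forall>a'\<in>F. a \<noteq> a' \<longrightarrow> cell a \<inter> cell a' = {}"
    proof (intro ballI impI, rule ccontr)
      fix a a' assume a: "a \<in> F" "a' \<in> F" "a \<noteq> a'" "cell a \<inter> cell a' \<noteq> {}"
      then obtain n where "n \<in> cell a" "n \<in> cell a'"
        by blast
      then have "a = a'"
        using a(1,2) unfolding F_def by (intro PiE_ext[of a "{..<s}" _ a']) (auto simp: cell)
      with a show False
        by simp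
    qed
  qed
  also have "\<dots> = (\<Sum>a\<in>F. 1)"
  proof (rule sum.cong)
    fix a assume "a \<in> F"
    then have "\<forall>i<s. a i < b ^ d i"
      using q by (auto simp: F_def PiE_iff intro: less_le_trans)
    then show "card (cell a) = 1"
      using net d by (simp add: is_net_def cell_def)
  qed simp
  also have "\<dots> = (\<Prod>i<s. q i - p i)"
    by (simp add: F_def card_PiE)
  finally show ?thesis .
qed

text \<open>Refining coordinate 0 alone, by the missing \<open>k\<close> digits, brings the total
  resolution to exactly \<open>m\<close> and reduces the count to
  \<open>card_net_in_box\<close>.\<close>

lemma card_net_in_coarse_box:
  assumes net: "is_net b m s P" and b: "b > 0" and s: "s > 0" and d: "(\<Sum>i<s. d i) \<le> m"
    and q: "\<And>i. i < s \<Longrightarrow> q i \<le> b ^ d i"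
  shows "card {n. n < b ^ m \<and> (\<forall>i<s. real (p i) / real b ^ d i \<le> P n i \<and> P n i < real (q i) / real b ^ d i)}
    = b ^ (m - (\<Sum>i<s. d i)) * (\<Prod>i<s. q i - p i)"
proof -
  define k where "k = m - (\<Sum>i<s. d i)"
  define e where "e i = (if i = 0 then k else 0)" for i :: nat
  have sum_e: "(\<Sum>i<s. e i) = k" and prod_e: "(\<Prod>i<s. b ^ e i) = b ^ k"
    using s by (simp_all add: e_def flip: power_sum)
  have "card {n. n < b ^ m \<and> (\<forall>i<s. real (p i * b ^ e i) / real b ^ (d i + e i) \<le> P n i
          \<and> P n i < real (q i * b ^ e i) / real b ^ (d i + e i))} = (\<Prod>i<s. q i * b ^ e i - p i * b ^ e i)"
    using q d sum_e by (intro card_net_in_box[OF net b]) (auto simp: sum.distrib k_def power_add)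
  also have "\<dots> = b ^ k * (\<Prod>i<s. q i - p i)"
    by (simp add: prod_e prod.distrib mult.commute flip: diff_mult_distrib)
  finally show ?thesis
    using b by (simp add: power_add k_def)
qed

text \<open>This coarsens a resolution vector that is too fine to one of total \<open>m\<close>, the
  only total about which the net property speaks. The last coordinate takes as much of
  \<open>m\<close> as it can.\<close>

lemma ex_pointwise_le_sum_eq:
  fixes J :: "nat \<Rightarrow> nat"
  assumes "m \<le> (\<Sum>i<s. J i)"
  shows "\<exists>d. (\<forall>i<s. d i \<le> J i) \<and> (\<Sum>i<s. d i) = m"
  using assms
proof (induction s arbitrary: m)
  case (Suc s)
  have "m - J s \<le> (\<Sum>i<s. J i)"
    using Suc.prems by simp
  then obtain d where d: "\<forall>i<s. d i \<le> J i" "(\<Sum>i<s. d i) = m - J s"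
    using Suc.IH by blast
  then have "(\<forall>i<Suc s. (d(s := min m (J s))) i \<le> J i) \<and> (\<Sum>i<Suc s. (d(s := min m (J s))) i) = m"
    by (auto simp: less_Suc_eq)
  then show ?case
    by blast
qed simp

text \<open>After coarsening \<open>J\<close> to total resolution \<open>m\<close>, nestedness of
  the \<open>b\<close>-adic intervals puts both points into one elementary box of volume
  \<open>b^-m\<close>.\<close>

lemma net_points_with_common_prefix_eq:
  assumes net: "is_net b m s P" and b: "b \<ge> 1" and c: "\<And>i j. c i j < b"
    and n: "n < b ^ m" "n' < b ^ m" and J: "m \<le> (\<Sum>i<s. J i)"
    and x: "\<And>i. i < s \<Longrightarrow> trunc b (c i) (J i) \<le> P n i \<and> P n i < trunc b (c i) (J i) + 1 / real b ^ J i"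
    and y: "\<And>i. i < s \<Longrightarrow> trunc b (c i) (J i) \<le> P n' i \<and> P n' i < trunc b (c i) (J i) + 1 / real b ^ J i"
  shows "n = n'"
proof -
  obtain d where d: "\<And>i. i < s \<Longrightarrow> d i \<le> J i" "(\<Sum>i<s. d i) = m"
    using ex_pointwise_le_sum_eq[OF J] by blast
  define S where "S = {k. k < b ^ m \<and> P k \<in> elem_box b s d (\<lambda>i. prefix_num b (c i) (d i))}"
  have "card S = 1"
    using net d(2) prefix_num_less[of "c _" b, OF c] by (simp add: is_net_def S_def)
  moreover have "k \<in> S" if "k < b ^ m"
    and z: "\<And>i. i < s \<Longrightarrow> trunc b (c i) (J i) \<le> P k i \<and> P k i < trunc b (c i) (J i) + 1 / real b ^ J i" for k
  proof -
    have "trunc b (c i) (d i) \<le> P k i \<and> P k i < trunc b (c i) (d i) + 1 / real b ^ d i" if "i < s" for i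
      using z[OF that] trunc_mono[OF b d(1)[OF that], of "c i"]
        trunc_upper_antimono[of b "c i", OF b c d(1)[OF that]] by linarith
    then show ?thesis
      using that(1) by (simp add: S_def elem_box_def trunc_def add_divide_distrib)
  qed
  ultimately show ?thesis
    using n x y by (metis card_1_singletonE singletonD)
qed

section \<open>The discrepancy function at points with finite expansions\<close>

text \<open>A real \<open>SUP\<close> bounds its members only when the set is bounded above. Every
  summand of \<open>local_disc\<close> has absolute value at most 1.\<close>

lemma bdd_above_local_disc:
  "bdd_above ((\<lambda>y. \<bar>local_disc s N P y\<bar> / real N) ` unit_cube s)"
proof (rule bdd_aboveI2)
  fix y assume "y \<in> unit_cube s"
  then have "0 \<le> (\<Prod>i<s. y i)" "(\<Prod>i<s. y i) \<le> 1"
    by (auto simp: unit_cube_def less_imp_le intro!: prod_nonneg prod_le_1)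
  then have "\<bar>(if \<forall>i<s. 0 \<le> P n i \<and> P n i < y i then 1 else 0) - (\<Prod>i<s. y i)\<bar> \<le> 1" for n
    by auto
  then have "\<bar>local_disc s N P y\<bar> \<le> (\<Sum>n<N. 1)"
    unfolding local_disc_def by (intro order_trans[OF sum_abs] sum_mono)
  then show "\<bar>local_disc s N P y\<bar> / real N \<le> 1"
    by (cases "N = 0") (simp_all add: divide_le_eq)
qed

lemma star_disc_ge:
  assumes "y \<in> unit_cube s"
  shows "\<bar>local_disc s N P y\<bar> / real N \<le> star_disc s N P"
  unfolding star_disc_def by (rule cSUP_upper[OF assms bdd_above_local_disc])

definition digit_point :: "nat \<Rightarrow> nat \<Rightarrow> nat \<Rightarrow> (nat \<Rightarrow> nat \<Rightarrow> nat) \<Rightarrow> nat \<Rightarrow> real" where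
  "digit_point b s L c i = (if i < s then trunc b (c i) L else 0)"

lemma digit_point_in_unit_cube:
  assumes "b \<ge> 1" "\<And>i j. c i j < b"
  shows "digit_point b s L c \<in> unit_cube s"
proof -
  have "trunc b (c i) L < 1" "0 \<le> trunc b (c i) L" for i
    using trunc_less[of b "c i" 0 L, OF assms(1,2)] trunc_mono[OF assms(1), of 0 L "c i"] by auto
  then show ?thesis
    by (simp add: unit_cube_def digit_point_def)
qed

text \<open>Both the indicator of the box and its volume are products over coordinates of sums over
  digit positions. Multiplying them out gives one term per tuple \<open>J\<close> of
  positions.\<close>

lemma local_disc_digit_point:
  assumes b: "b \<ge> 1"
  shows "local_disc s N P (digit_point b s L c) =
    (\<Sum>J\<in>PiE {..<s} (\<lambda>_. {..<L}).
      real (card {n. n < N \<and> (\<forall>i<s. trunc b (c i) (J i) \<le> P n i \<and> P n i < trunc b (c i) (Suc (J i)))})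
      - real N * (\<Prod>i<s. real (c i (J i)) / real b ^ Suc (J i)))"
proof -
  let ?F = "PiE {..<s} (\<lambda>_. {..<L})"
  define hit where "hit n i j = (if trunc b (c i) j \<le> P n i \<and> P n i < trunc b (c i) (Suc j) then 1 else 0 :: real)"
    for n i j
  have vol: "trunc b (c i) L = (\<Sum>j<L. real (c i j) / real b ^ Suc j)" for i
    by (induction L) (simp_all add: trunc_Suc[OF b])
  have ind: "(if \<forall>i<s. 0 \<le> P n i \<and> P n i < digit_point b s L c i then 1 else 0) = (\<Sum>J\<in>?F. \<Prod>i<s. hit n i (J i))" for n
  proof -
    have "(if \<forall>i<s. 0 \<le> P n i \<and> P n i < digit_point b s L c i then 1 else 0 :: real) =
        (\<Prod>i<s. if 0 \<le> P n i \<and> P n i < trunc b (c i) L then 1 else 0)"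
      by (auto simp: digit_point_def)
    also have "\<dots> = (\<Prod>i<s. \<Sum>j<L. hit n i j)"
      by (simp add: indicator_trunc_eq_sum[OF b] hit_def)
    also have "\<dots> = (\<Sum>J\<in>?F. \<Prod>i<s. hit n i (J i))"
      by (rule prod_sum_PiE) auto
    finally show ?thesis .
  qed
  have "(\<Prod>i<s. digit_point b s L c i) = (\<Prod>i<s. \<Sum>j<L. real (c i j) / real b ^ Suc j)"
    by (simp add: digit_point_def vol)
  also have "\<dots> = (\<Sum>J\<in>?F. \<Prod>i<s. real (c i (J i)) / real b ^ Suc (J i))"
    by (rule prod_sum_PiE) auto
  finally have vol': "(\<Prod>i<s. digit_point b s L c i) = \<dots>" .
  have cnt: "(\<Sum>n<N. \<Prod>i<s. hit n i (J i)) =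
      real (card {n. n < N \<and> (\<forall>i<s. trunc b (c i) (J i) \<le> P n i \<and> P n i < trunc b (c i) (Suc (J i)))})" for J
  proof -
    let ?Q = "\<lambda>n. \<forall>i<s. trunc b (c i) (J i) \<le> P n i \<and> P n i < trunc b (c i) (Suc (J i))"
    have "(\<Sum>n<N. \<Prod>i<s. hit n i (J i)) = (\<Sum>n<N. if ?Q n then 1 else 0)"
      by (intro sum.cong) (auto simp: hit_def)
    also have "\<dots> = real (card ({..<N} \<inter> {n. ?Q n}))"
      by (simp add: sum.If_cases)
    also have "{..<N} \<inter> {n. ?Q n} = {n. n < N \<and> ?Q n}"
      by auto
    finally show ?thesis .
  qed
  have "local_disc s N P (digit_point b s L c) =
      (\<Sum>n<N. \<Sum>J\<in>?F. (\<Prod>i<s. hit n i (J i)) - (\<Prod>i<s. real (c i (J i)) / real b ^ Suc (J i)))"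
    unfolding local_disc_def ind vol' by (simp add: sum_subtractf)
  also have "\<dots> = (\<Sum>J\<in>?F. \<Sum>n<N. (\<Prod>i<s. hit n i (J i)) - (\<Prod>i<s. real (c i (J i)) / real b ^ Suc (J i)))"
    by (rule sum.swap)
  finally show ?thesis
    by (simp add: sum_subtractf cnt)
qed

text \<open>No term of the expansion is positive, so all terms outside the set counted on the right
  may be dropped. Tuples hitting a digit 0 give empty boxes, which is why \<open>gap\<close> is
  assumed for nonzero digits alone.\<close>

lemma local_disc_digit_point_le:
  assumes net: "is_net b m s P" and b: "b \<ge> 1" and s: "s \<ge> 1" and c: "\<And>i j. c i j < b"
    and n0: "n0 < b ^ m" "P n0 = digit_point b s L c"
    and gap: "\<And>J. J \<in> PiE {..<s} (\<lambda>_. {..<L}) \<Longrightarrow> \<forall>i<s. c i (J i) \<noteq> 0 \<Longrightarrow>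
      (\<Sum>i<s. J i) + s \<le> m \<or> m \<le> (\<Sum>i<s. J i)"
  shows "local_disc s (b ^ m) P (digit_point b s L c) \<le>
    - (((real b - 1) / real b) ^ s *
       real (card {J \<in> PiE {..<s} (\<lambda>_. {..<L}). (\<Sum>i<s. J i) = m \<and> (\<forall>i<s. c i (J i) = b - 1)}))"
proof -
  let ?F = "PiE {..<s} (\<lambda>_. {..<L})"
  let ?G = "{J \<in> ?F. (\<Sum>i<s. J i) = m \<and> (\<forall>i<s. c i (J i) = b - 1)}"
  let ?S = "\<lambda>J. {n. n < b ^ m \<and> (\<forall>i<s. trunc b (c i) (J i) \<le> P n i \<and> P n i < trunc b (c i) (Suc (J i)))}"
  let ?v = "\<lambda>J. \<Prod>i<s. real (c i (J i)) / real b ^ Suc (J i)"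
  have fin: "finite ?F"
    by (intro finite_PiE) auto
  have vol: "?v J = (\<Prod>i<s. real (c i (J i))) / real b ^ ((\<Sum>i<s. J i) + s)" for J
  proof -
    have "(\<Prod>i<s. real b ^ Suc (J i)) = real b ^ (\<Sum>i<s. Suc (J i))"
      by (rule power_sum[symmetric])
    also have "(\<Sum>i<s. Suc (J i)) = (\<Sum>i<s. J i) + s"
      by (simp add: sum_Suc)
    finally show ?thesis
      by (simp only: prod_dividef)
  qed
  have empty: "?S J = {}" if J: "J \<in> ?F" "m \<le> (\<Sum>i<s. J i)" for J
  proof (rule ccontr)
    assume "?S J \<noteq> {}"
    then obtain n where n: "n < b ^ m"
      and x: "\<And>i. i < s \<Longrightarrow> trunc b (c i) (J i) \<le> P n i \<and> P n i < trunc b (c i) (Suc (J i))"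
      by blast
    have JL: "Suc (J i) \<le> L" if "i < s" for i
      using J(1) that by (auto simp: PiE_iff Suc_le_eq)
    have "n = n0"
    proof (rule net_points_with_common_prefix_eq[OF net b c n n0(1) J(2)])
      fix i assume i: "i < s"
      show "trunc b (c i) (J i) \<le> P n i \<and> P n i < trunc b (c i) (J i) + 1 / real b ^ J i"
        using x[OF i] trunc_less[of b "c i" "J i" "Suc (J i)", OF b c] by auto
      show "trunc b (c i) (J i) \<le> P n0 i \<and> P n0 i < trunc b (c i) (J i) + 1 / real b ^ J i"
        using i JL[OF i] trunc_less[of b "c i" "J i" L, OF b c] trunc_mono[OF b, of "J i" L "c i"]
        by (simp add: n0(2) digit_point_def)
    qed
    \<comment> \<open>The point found is \<open>P n0\<close> itself, whose coordinate 0 is at least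
      the excluded right end of the box.\<close>
    then show False
      using x[of 0] s n0(2) JL[of 0] trunc_mono[OF b, of "Suc (J 0)" L "c 0"]
      by (simp add: digit_point_def)
  qed
  have coarse: "real (card (?S J)) = real (b ^ m) * ?v J" if J: "(\<Sum>i<s. J i) + s \<le> m" for J
  proof -
    have d: "(\<Sum>i<s. Suc (J i)) = (\<Sum>i<s. J i) + s"
      by (simp add: sum_Suc)
    \<comment> \<open>The left end is written with one more digit, 0, so that both ends have
      denominator \<open>b ^ Suc (J i)\<close>.\<close>
    have "trunc b (c i) (J i) = real (b * prefix_num b (c i) (J i)) / real b ^ Suc (J i)" for i
      using b by (simp add: trunc_def)
    then have "card (?S J) = card {n. n < b ^ m \<and> (\<forall>i<s.
        real (b * prefix_num b (c i) (J i)) / real b ^ Suc (J i) \<le> P n i \<and>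
        P n i < real (prefix_num b (c i) (Suc (J i))) / real b ^ Suc (J i))}"
      by (simp only: trunc_def[of _ _ "Suc _"])
    also have "\<dots> = b ^ (m - (\<Sum>i<s. Suc (J i))) *
        (\<Prod>i<s. prefix_num b (c i) (Suc (J i)) - b * prefix_num b (c i) (J i))"
    proof (rule card_net_in_coarse_box[OF net])
      show "prefix_num b (c i) (Suc (J i)) \<le> b ^ Suc (J i)" for i
        by (rule less_imp_le[OF prefix_num_less[OF c]])
    qed (use b s d J in auto)
    finally have "card (?S J) = b ^ (m - ((\<Sum>i<s. J i) + s)) * (\<Prod>i<s. c i (J i))"
      by (simp add: d)
    moreover have "real (b ^ (m - ((\<Sum>i<s. J i) + s))) = real b ^ m / real b ^ ((\<Sum>i<s. J i) + s)"
      unfolding of_nat_power using b J by (intro power_diff) auto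
    ultimately show ?thesis
      by (simp add: vol del: power_Suc of_nat_power)
  qed
  have nonpos: "real (card (?S J)) - real (b ^ m) * ?v J \<le> 0" if J: "J \<in> ?F" for J
  proof (cases "\<forall>i<s. c i (J i) \<noteq> 0")
    case True
    then consider "(\<Sum>i<s. J i) + s \<le> m" | "m \<le> (\<Sum>i<s. J i)"
      using gap[OF J] by blast
    then show ?thesis
    proof cases
      case 1
      then show ?thesis
        using coarse[of J] by simp
    next
      case 2
      have "0 \<le> ?v J"
        by (intro prod_nonneg) auto
      then show ?thesis
        by (simp only: empty[OF J 2]) simp
    qed
  next
    case False
    then obtain i where i: "i < s" "c i (J i) = 0"
      by blast
    then have "trunc b (c i) (Suc (J i)) = trunc b (c i) (J i)"
      by (simp add: trunc_Suc[OF b])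
    then have "?S J = {}"
      using i(1) by fastforce
    moreover have "0 \<le> ?v J"
      by (intro prod_nonneg) auto
    ultimately show ?thesis
      by (simp only:) simp
  qed
  have good: "real (card (?S J)) - real (b ^ m) * ?v J = - (((real b - 1) / real b) ^ s)" if J: "J \<in> ?G" for J
  proof -
    have "?S J = {}"
      using J by (intro empty) auto
    \<comment> \<open>The volume is \<open>(b - 1) ^ s / b ^ (m + s)\<close>, as all digits are
      \<open>b - 1\<close> and \<open>J\<close> sums to \<open>m\<close>.\<close>
    moreover have "real (b ^ m) * ?v J = ((real b - 1) / real b) ^ s"
      unfolding vol using J b by (simp add: power_add power_divide of_nat_diff)
    ultimately show ?thesis
      by (simp only:) simp
  qed
  have "local_disc s (b ^ m) P (digit_point b s L c) = (\<Sum>J\<in>?F. real (card (?S J)) - real (b ^ m) * ?v J)"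
    by (rule local_disc_digit_point[OF b])
  also have "\<dots> \<le> (\<Sum>J\<in>?G. real (card (?S J)) - real (b ^ m) * ?v J)"
  proof -
    have "(\<Sum>J\<in>?G. - (real (card (?S J)) - real (b ^ m) * ?v J)) \<le> (\<Sum>J\<in>?F. - (real (card (?S J)) - real (b ^ m) * ?v J))"
      using nonpos by (intro sum_mono2[OF fin]) (auto simp del: of_nat_power)
    then show ?thesis
      unfolding sum_negf by linarith
  qed
  also have "\<dots> = (\<Sum>J\<in>?G. - (((real b - 1) / real b) ^ s))"
    by (rule sum.cong[OF refl good])
  finally show ?thesis
    by (simp add: mult.commute)
qed

section \<open>Approximating a point by its first digits\<close>

lemma floor_mult_base_div:
  fixes x :: real
  assumes "b > 0" "0 \<le> x"
  shows "nat \<lfloor>x * real b\<rfloor> div b = nat \<lfloor>x\<rfloor>"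
proof -
  have "\<lfloor>x * real b / real_of_int (int b)\<rfloor> = \<lfloor>x * real b\<rfloor> div int b"
    by (rule floor_divide_real_eq_div) simp
  then have "\<lfloor>x\<rfloor> = \<lfloor>x * real b\<rfloor> div int b"
    using assms by simp
  then show ?thesis
    using assms by (simp add: nat_div_distrib)
qed

lemma prefix_num_digits:
  assumes b: "b > 0" and x: "0 \<le> x" "x < 1"
    and c: "\<And>j. j < A \<Longrightarrow> c j = nat \<lfloor>x * real b ^ Suc j\<rfloor> mod b" and "k \<le> A"
  shows "prefix_num b c k = nat \<lfloor>x * real b ^ k\<rfloor>"
  using \<open>k \<le> A\<close>
proof (induction k)
  case 0
  then show ?case
    using x by (simp add: floor_eq_iff)
next
  case (Suc k)
  have "nat \<lfloor>x * real b ^ Suc k\<rfloor> div b = prefix_num b c k"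
    using Suc floor_mult_base_div[OF b, of "x * real b ^ k"] x by (simp add: mult_ac)
  moreover have "c k = nat \<lfloor>x * real b ^ Suc k\<rfloor> mod b"
    using c Suc.prems by simp
  ultimately show ?case
    by (metis mult_div_mod_eq prefix_num.simps(2))
qed

text \<open>Both numbers lie in the half-open \<open>b\<close>-adic interval of length
  \<open>b^-A\<close> fixed by the common first \<open>A\<close> digits.\<close>

lemma trunc_digits_close:
  assumes b: "b > 0" and x: "0 \<le> x" "x < 1" and "\<And>j. c j < b" "A \<le> L"
    and "\<And>j. j < A \<Longrightarrow> c j = nat \<lfloor>x * real b ^ Suc j\<rfloor> mod b"
  shows "\<bar>x - trunc b c L\<bar> < 1 / real b ^ A"
proof -
  have b1: "b \<ge> 1"
    using b by simp
  have "prefix_num b c A = nat \<lfloor>x * real b ^ A\<rfloor>"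
    by (rule prefix_num_digits[OF b x assms(6)]) auto
  then have "trunc b c A \<le> x \<and> x < trunc b c A + 1 / real b ^ A"
    using mem_interval_iff_floor[OF b x(1), of "prefix_num b c A" A]
    by (simp add: trunc_def add_divide_distrib)
  moreover have "trunc b c A \<le> trunc b c L"
    by (rule trunc_mono[OF b1 \<open>A \<le> L\<close>])
  moreover have "trunc b c L < trunc b c A + 1 / real b ^ A"
    using assms by (intro trunc_less) auto
  ultimately show ?thesis
    by linarith
qed

lemma eucl_dist_less:
  assumes "s > 0" "\<And>i. i < s \<Longrightarrow> \<bar>x i - y i\<bar> < e"
  shows "eucl_dist s x y < sqrt (real s) * e"
proof -
  have e: "0 < e"
    using assms(2)[OF assms(1)] by linarith
  have "(\<Sum>i<s. (x i - y i)\<^sup>2) < (\<Sum>i<s. e\<^sup>2)"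
  proof (rule sum_strict_mono)
    fix i assume "i \<in> {..<s}"
    then have "\<bar>x i - y i\<bar> < \<bar>e\<bar>"
      using assms(2)[of i] e by simp
    then show "(x i - y i)\<^sup>2 < e\<^sup>2"
      by (simp add: abs_le_square_iff flip: not_le)
  qed (use assms(1) in auto)
  then have "eucl_dist s x y < sqrt (real s * e\<^sup>2)"
    unfolding eucl_dist_def by simp
  then show ?thesis
    using e by (simp add: real_sqrt_mult)
qed

section \<open>Congruence conditions on digit positions\<close>

text \<open>Coordinates other than 0 use the class of the last position \<open>K\<close>; coordinate
  0 uses the class that makes the total congruent to \<open>m\<close>. The term
  \<open>(s - 1) * K\<close> stands on the left to avoid subtraction of naturals.\<close>

definition admissible_pos :: "nat \<Rightarrow> nat \<Rightarrow> nat \<Rightarrow> nat \<Rightarrow> nat \<Rightarrow> bool" where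
  "admissible_pos s m K i j \<longleftrightarrow>
    (if i = 0 then (j + (s - 1) * K) mod s = m mod s else j mod s = K mod s)"

lemma sum_lessThan_split_0:
  fixes J :: "nat \<Rightarrow> nat"
  assumes "s > 0"
  shows "(\<Sum>i<s. J i) = J 0 + (\<Sum>i\<in>{1..<s}. J i)"
proof -
  have "{..<s} = insert 0 {1..<s}"
    using assms by auto
  then show ?thesis
    by simp
qed

lemma admissible_pos_sum_mod:
  assumes "s > 0" "\<And>i. i < s \<Longrightarrow> admissible_pos s m K i (J i)"
  shows "(\<Sum>i<s. J i) mod s = m mod s"
proof -
  have "(\<Sum>i\<in>{1..<s}. J i) mod s = (\<Sum>i\<in>{1..<s}. J i mod s) mod s"
    by (simp add: mod_sum_eq)
  also have "(\<Sum>i\<in>{1..<s}. J i mod s) = (\<Sum>i\<in>{1..<s}. K mod s)"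
    using assms(2) by (intro sum.cong) (auto simp: admissible_pos_def)
  also have "\<dots> mod s = ((s - 1) * K) mod s"
    by (simp add: mod_mult_right_eq)
  finally have "(J 0 + (\<Sum>i\<in>{1..<s}. J i)) mod s = (J 0 + (s - 1) * K) mod s"
    by (metis mod_add_right_eq)
  also have "\<dots> = m mod s"
    using assms(2)[of 0] assms(1) by (simp add: admissible_pos_def)
  finally show ?thesis
    by (simp add: sum_lessThan_split_0[OF assms(1)])
qed

text \<open>If some entry is below \<open>A\<close>, the sum is at most
  \<open>A - 1 + (s - 1) * K\<close>, and adding \<open>s\<close> gives exactly the left side of the
  assumption on \<open>m\<close>. Otherwise the sum is congruent to \<open>m\<close> modulo
  \<open>s\<close>, so it cannot fall short of \<open>m\<close> by less than
  \<open>s\<close>.\<close>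

lemma admissible_pos_gap:
  assumes s: "s > 0" and m: "A + (s - 1) * Suc K \<le> m"
    and J: "\<And>i. i < s \<Longrightarrow> J i \<le> K"
    and adm: "\<And>i. i < s \<Longrightarrow> A \<le> J i \<Longrightarrow> admissible_pos s m K i (J i)"
  shows "(\<Sum>i<s. J i) + s \<le> m \<or> m \<le> (\<Sum>i<s. J i)"
proof (cases "\<exists>i<s. J i < A")
  case True
  then obtain i where i: "i < s" "J i < A"
    by blast
  have "(\<Sum>k\<in>{..<s} - {i}. J k) \<le> (\<Sum>k\<in>{..<s} - {i}. K)"
    using J by (intro sum_mono) auto
  then have "(\<Sum>k<s. J k) \<le> J i + (s - 1) * K"
    using i(1) by (simp add: sum.remove[of "{..<s}" i])
  moreover have "(s - 1) * Suc K = (s - 1) * K + (s - 1)"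
    by simp
  ultimately show ?thesis
    using i m s by linarith
next
  case False
  then have "(\<Sum>i<s. J i) mod s = m mod s"
    using adm False by (intro admissible_pos_sum_mod[where K = K, OF s]) (meson not_less)
  then have "s dvd m - (\<Sum>i<s. J i)" if "(\<Sum>i<s. J i) < m"
    using that by (metis less_imp_le mod_eq_dvd_iff_nat)
  then have "s \<le> m - (\<Sum>i<s. J i)" if "(\<Sum>i<s. J i) < m"
    using that by (simp add: dvd_imp_le)
  then show ?thesis
    by linarith
qed

text \<open>Entries \<open>K - s * u i\<close> with \<open>u i < U\<close> are chosen freely for
  \<open>i \<ge> 1\<close>, and entry 0 is forced by the sum. The assumption on \<open>U\<close>
  says that entry 0 stays at most \<open>K\<close> even if every \<open>u i\<close> is
  \<open>U - 1\<close>.\<close>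

lemma card_admissible_ge:
  assumes s: "s \<ge> 2" and m: "A + (s - 1) * Suc K \<le> m" and U: "m + s * (s - 1) * (U - 1) \<le> s * K"
  shows "U ^ (s - 1) \<le> card {J \<in> PiE {..<s} (\<lambda>_. {..<Suc K}). (\<Sum>i<s. J i) = m \<and>
    (\<forall>i<s. A \<le> J i \<and> admissible_pos s m K i (J i))}"
    (is "_ \<le> card ?G")
proof -
  define V where "V = PiE {1..<s} (\<lambda>_. {..<U})"
  define R where "R u = (\<Sum>k\<in>{1..<s}. K - s * u k)" for u
  define f where "f u = (\<lambda>i\<in>{..<s}. if i = 0 then m - R u else K - s * u i)" for u
  have sK: "s * K = (s - 1) * K + K"
    using s by (cases s) auto
  have mK: "(s - 1) * K + A \<le> m"
    using m by simp
  \<comment> \<open>This keeps the natural subtraction \<open>K - s * u i\<close> from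
    truncating.\<close>
  have bound: "s * u i \<le> K" if "u \<in> V" "i \<in> {1..<s}" for u i
  proof -
    have "u i \<le> U - 1"
      using that PiE_mem[of u "{1..<s}" "\<lambda>_. {..<U}" i] by (simp add: V_def)
    then have "s * u i \<le> s * (U - 1)"
      by simp
    also have "\<dots> \<le> s * (s - 1) * (U - 1)"
      using s by (intro mult_le_mono1) simp
    also have "\<dots> \<le> K"
      using U sK mK by linarith
    finally show ?thesis .
  qed
  have R: "R u + s * (\<Sum>k\<in>{1..<s}. u k) = (s - 1) * K" if "u \<in> V" for u
  proof -
    have "R u + s * (\<Sum>k\<in>{1..<s}. u k) = (\<Sum>k\<in>{1..<s}. (K - s * u k) + s * u k)"
      by (simp add: R_def sum.distrib sum_distrib_left)
    also have "\<dots> = (\<Sum>k\<in>{1..<s}. K)"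
      using bound[OF that] by (intro sum.cong) auto
    finally show ?thesis
      by simp
  qed
  have fG: "f u \<in> ?G" if u: "u \<in> V" for u
  proof -
    have Rm: "R u \<le> m"
      using R[OF u] mK by linarith
    have "(\<Sum>k\<in>{1..<s}. u k) \<le> (\<Sum>k\<in>{1..<s}. U - 1)"
      using u PiE_mem[of u "{1..<s}" "\<lambda>_. {..<U}"] by (intro sum_mono) (fastforce simp: V_def)
    then have "s * (\<Sum>k\<in>{1..<s}. u k) \<le> s * ((s - 1) * (U - 1))"
      by simp
    then have top: "m - R u \<le> K"
      using R[OF u] U sK by (simp only: mult.assoc)
    have le: "f u i \<le> K" if "i < s" for i
      using that top by (simp add: f_def)
    have "(\<Sum>i\<in>{1..<s}. f u i) = R u"
      unfolding R_def by (intro sum.cong) (auto simp: f_def)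
    then have sum: "(\<Sum>i<s. f u i) = m"
      using Rm s by (simp add: sum_lessThan_split_0 f_def)
    \<comment> \<open>The other \<open>s - 1\<close> entries are at most \<open>K\<close>, which
      leaves at least \<open>m - (s - 1) * K\<close> for entry \<open>i\<close>.\<close>
    have ge: "A \<le> f u i" if "i < s" for i
    proof -
      have "(\<Sum>k\<in>{..<s} - {i}. f u k) \<le> (\<Sum>k\<in>{..<s} - {i}. K)"
        using le by (intro sum_mono) auto
      then have "m \<le> f u i + (s - 1) * K"
        using that sum by (simp add: sum.remove[of "{..<s}" i])
      then show ?thesis
        using mK by linarith
    qed
    have "admissible_pos s m K i (f u i)" if "i < s" for i
    proof (cases "i = 0")
      case True
      have "m - R u + (s - 1) * K = m + s * (\<Sum>k\<in>{1..<s}. u k)"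
        using R[OF u] Rm by linarith
      then show ?thesis
        using True s by (simp add: admissible_pos_def f_def)
    next
      case False
      then have "K = f u i + s * u i"
        using that bound[OF u, of i] by (simp add: f_def)
      then have "f u i mod s = K mod s"
        by (metis mod_mult_self2)
      then show ?thesis
        using False by (simp add: admissible_pos_def)
    qed
    then show ?thesis
      using le ge sum by (auto simp: PiE_iff less_Suc_eq_le f_def extensional_def)
  qed
  have "inj_on f V"
  proof (rule inj_onI)
    fix u v assume uv: "u \<in> V" "v \<in> V" "f u = f v"
    show "u = v"
    proof (rule PiE_ext)
      show "u \<in> PiE {1..<s} (\<lambda>_. {..<U})" "v \<in> PiE {1..<s} (\<lambda>_. {..<U})"
        using uv by (simp_all add: V_def)
      fix i assume i: "i \<in> {1..<s}"
      then have "K - s * u i = K - s * v i"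
        using fun_cong[OF uv(3), of i] by (simp add: f_def)
      then have "s * u i = s * v i"
        using bound[OF uv(1) i] bound[OF uv(2) i] by linarith
      then show "u i = v i"
        using s by simp
    qed
  qed
  moreover have "f ` V \<subseteq> ?G"
    using fG by blast
  moreover have "finite ?G"
    by (intro finite_subset[OF _ finite_PiE[of "{..<s}" "\<lambda>_. {..<Suc K}"]]) auto
  ultimately have "card V \<le> card ?G"
    by (rule card_inj_on_le)
  then show ?thesis
    by (simp add: V_def card_PiE)
qed

section \<open>Choice of the parameters\<close>

text \<open>The factor \<open>2s - 3\<close> comes from
  \<open>s / (s - 1) * (1 - 1 / (2 * s * (s - 1))) = 1 + (2 * s - 3) / (2 * (s - 1)\<^sup>2)\<close>,
  which is \<open>s * L / m\<close> up to rounding.\<close>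

lemma parameters_exist:
  fixes s m A L :: nat
  assumes s: "s \<ge> 2" and m: "m \<ge> 2 * s\<^sup>2 * (s - 1)\<^sup>2"
    and A_def: "A = m div (2 * (s - 1) * s)" and L_def: "L = (m - A) div (s - 1)"
  shows "\<exists>K U. L = Suc K \<and> A \<le> L \<and> A + (s - 1) * Suc K \<le> m \<and> m + s * (s - 1) * (U - 1) \<le> s * K \<and>
    (2 * real s - 3) * real m / (4 * real s ^ 2 * (real s - 1) ^ 2) \<le> real U"
proof -
  obtain t where t: "s = Suc t" "t \<ge> 1"
    using s by (cases s) auto
  have mst: "2 * s\<^sup>2 * t\<^sup>2 \<le> m"
    using m t by simp
  have A: "2 * t * s * A \<le> m"
    unfolding A_def using t by (simp add: mult.commute)
  have "A \<le> m"
    by (simp add: A_def)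
  have tL: "t * L \<le> m - A"
    unfolding L_def using t by simp
  have "m - A < t * Suc L"
    unfolding L_def using t by (simp add: dividend_less_times_div)
  then have tL': "m + 1 \<le> A + t * L + t"
    using \<open>A \<le> m\<close> by simp
  have "s * (m + 1) \<le> s * (A + t * L + t)"
    using tL' by (rule mult_le_mono2)
  then have stL: "s * m + s \<le> s * A + t * (s * L) + s * t"
    by (simp add: algebra_simps)
  have sA: "2 * (s * A) \<le> m"
  proof -
    have "2 * (s * A) * 1 \<le> 2 * (s * A) * t"
      using t by (intro mult_le_mono2)
    also have "\<dots> = 2 * t * s * A"
      by (simp add: mult_ac)
    finally show ?thesis
      using A by linarith
  qed
  have st: "2 * (s * t) \<le> s\<^sup>2 * t\<^sup>2"
  proof -
    have "2 * 1 \<le> s * t"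
      using s t by (intro mult_le_mono) auto
    then have "2 * (s * t) \<le> (s * t) * (s * t)"
      by (intro mult_le_mono1) simp
    then show ?thesis
      by (simp add: power2_eq_square mult_ac)
  qed
  have "s * m = t * m + m"
    using t by simp
  \<comment> \<open>The losses \<open>s * A\<close> and \<open>2 * (s * t)\<close> are each at most
    \<open>m / 2\<close>.\<close>
  then have "t * (m + s) \<le> t * (s * L)"
    using stL sA st mst by (simp add: algebra_simps)
  then have sL: "m + s \<le> s * L"
    by (rule mult_left_le_imp_le) (use t in simp)
  then obtain K where K: "L = Suc K"
    using t by (cases L) auto
  \<comment> \<open>The largest value with \<open>m + s * t * (U - 1) \<le> s * K\<close>, the
    condition in \<open>card_admissible_ge\<close>.\<close>
  define U where "U = (s * K - m) div (s * t) + 1"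
  have mK: "m \<le> s * K"
    using sL K by simp
  have "s * t * (U - 1) \<le> s * K - m"
    unfolding U_def by simp
  then have U1: "m + s * t * (U - 1) \<le> s * K"
    using mK by linarith
  have "s * K - m < s * t * U"
    unfolding U_def using t dividend_less_times_div[of "s * t" "s * K - m"] by simp
  then have U2: "s * L + 1 \<le> s * t * U + s + m"
    using mK K by simp
  have "A \<le> L"
  proof -
    have "s * A \<le> s * L"
      using sA sL by linarith
    then show ?thesis
      by (rule mult_left_le_imp_le) (use t in simp)
  qed
  have "t * (s * L + 1) \<le> t * (s * t * U + s + m)"
    using U2 by (rule mult_le_mono2)
  then have "s * m + s + t \<le> s * A + 2 * (s * t) + s * t * t * U + t * m"
    using stL by (simp add: algebra_simps)
  then have N: "m + s + t \<le> s * A + 2 * (s * t) + s * t * t * U"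
    using \<open>s * m = t * m + m\<close> by linarith
  have rN: "real m + real s + real t \<le> real s * real A + 2 * (real s * real t) + real s * real t * real t * real U"
    using of_nat_mono[where 'a = real, OF N] by simp
  define \<sigma> \<tau> M where "\<sigma> = real s" and "\<tau> = real t" and "M = real m"
  have \<sigma>: "\<sigma> = \<tau> + 1" and \<tau>: "\<tau> \<ge> 1"
    using t by (simp_all add: \<sigma>_def \<tau>_def)
  have \<sigma>\<tau>: "\<sigma> * \<tau> \<ge> 2"
    using mult_mono[of 2 \<sigma> 1 \<tau>] \<sigma> \<tau> by simp
  have M: "M \<ge> 2 * (\<sigma> * \<tau>) * (\<sigma> * \<tau>)"
    using of_nat_mono[where 'a = real, OF mst] unfolding M_def \<sigma>_def \<tau>_def
    by (simp add: power2_eq_square mult_ac)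
  have "4 * \<sigma> * \<tau> * (M + \<sigma> + \<tau>) \<le> 4 * \<sigma> * \<tau> * (\<sigma> * real A + 2 * (\<sigma> * \<tau>) + \<sigma> * \<tau> * \<tau> * real U)"
    using rN \<tau> \<sigma> unfolding M_def \<sigma>_def \<tau>_def by (intro mult_left_mono) auto
  moreover have "2 * \<sigma> * (2 * \<tau> * \<sigma> * real A) \<le> 2 * \<sigma> * M"
    using of_nat_mono[where 'a = real, OF A] unfolding M_def \<sigma>_def \<tau>_def
    by (intro mult_left_mono) simp_all
  \<comment> \<open>With \<open>\<sigma> = \<tau> + 1\<close>, the left side collects the rounding
    losses. The factor of \<open>M\<close> on the right is the excess of the available coefficient
    \<open>2 * \<sigma> * (2 * \<tau> - 1)\<close> over the required
    \<open>\<tau> * (2 * \<tau> - 1)\<close>.\<close>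
  moreover have "4 * (\<sigma> * \<tau>) * (2 * \<tau>\<^sup>2 - 1) \<le> M * (2 * \<tau>\<^sup>2 + 3 * \<tau> - 2)"
  proof -
    have "4 * (\<sigma> * \<tau>) * (2 * \<tau>\<^sup>2 - 1) \<le> 4 * (\<sigma> * \<tau>) * (2 * \<tau>\<^sup>2 + 3 * \<tau> - 2)"
      using \<sigma>\<tau> \<tau> by (intro mult_left_mono) auto
    also have "\<dots> \<le> M * (2 * \<tau>\<^sup>2 + 3 * \<tau> - 2)"
    proof (rule mult_right_mono)
      have "(\<sigma> * \<tau>) * 2 \<le> (\<sigma> * \<tau>) * (\<sigma> * \<tau>)"
        using \<sigma>\<tau> by (intro mult_left_mono) auto
      then show "4 * (\<sigma> * \<tau>) \<le> M"
        using M by linarith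
      show "0 \<le> 2 * \<tau>\<^sup>2 + 3 * \<tau> - 2"
        using \<tau> zero_le_power2[of \<tau>] by linarith
    qed
    finally show ?thesis .
  qed
  ultimately have "\<tau> * ((2 * \<tau> - 1) * M) \<le> \<tau> * (4 * \<sigma>\<^sup>2 * \<tau>\<^sup>2 * real U)"
    unfolding \<sigma> by (simp add: algebra_simps power2_eq_square)
  then have "(2 * \<tau> - 1) * M \<le> 4 * \<sigma>\<^sup>2 * \<tau>\<^sup>2 * real U"
    using \<tau> by simp
  then have "(2 * \<sigma> - 3) * M / (4 * \<sigma>\<^sup>2 * (\<sigma> - 1)\<^sup>2) \<le> real U"
    using \<tau> \<sigma> by (simp add: divide_le_eq mult_ac)
  then have "(2 * real s - 3) * real m / (4 * real s ^ 2 * (real s - 1) ^ 2) \<le> real U"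
    by (simp add: \<sigma>_def M_def)
  moreover have "A + (s - 1) * Suc K \<le> m"
    using tL \<open>A \<le> m\<close> K t by simp
  moreover have "m + s * (s - 1) * (U - 1) \<le> s * K"
    using U1 t by simp
  ultimately show ?thesis
    using K \<open>A \<le> L\<close> by blast
qed

text \<open>Rounding \<open>m / k\<close> down changes the exponent by less than 1; this is the
  source of the factor \<open>b\<close> in the covering radius.\<close>

lemma inverse_power_div_le_powr:
  assumes "b \<ge> 2" "k > 0"
  shows "1 / real b ^ (m div k) \<le> real b / real b powr (real m / real k)"
proof -
  have "m < k * Suc (m div k)"
    using assms(2) by (rule dividend_less_times_div[THEN order_less_le_trans]) simp
  then have "real m < real k * real (Suc (m div k))"
    by (simp only: flip: of_nat_mult of_nat_less_iff)
  then have "real m / real k \<le> real (Suc (m div k))"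
    using assms(2) by (simp add: divide_le_eq mult.commute)
  then have "real b powr (real m / real k) \<le> real b powr real (Suc (m div k))"
    using assms(1) by (intro powr_mono) auto
  also have "\<dots> = real b * real b ^ (m div k)"
    using assms(1) by (subst powr_realpow) auto
  finally show ?thesis
    using assms(1) by (simp add: field_simps)
qed

section \<open>Covering property and discrepancy bound\<close>

theorem theorem4:
  fixes b s m :: nat
  assumes "b \<ge> 2" and "s \<ge> 2" and "m \<ge> 2 * s^s * (s-1)^s"
  shows "\<exists>\<Gamma>. \<Gamma> \<subseteq> unit_cube s \<and>
    (\<forall>x\<in>unit_cube s. \<exists>\<gamma>\<in>\<Gamma>.
        eucl_dist s x \<gamma> < real b * sqrt (real s) / real b powr (real m / (2 * (real s - 1) * real s))) \<and>
    (\<forall>P. is_net b m s P \<longrightarrow> (\<exists>i<b^m. P i \<in> \<Gamma>) \<longrightarrow>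
        star_disc s (b^m) P \<ge>
          (real b - 1)^s * (2 * real s - 3)^(s-1) /
            (real b ^ s * (4 * real s^2 * (real s - 1)^2 * ln (real b))^(s-1))
          * ln (real (b^m))^(s-1) / real (b^m))"
proof -
  define A where "A = m div (2 * (s - 1) * s)"
  define L where "L = (m - A) div (s - 1)"
  have b: "b > 0" "b \<ge> 1" and s: "s > 0" "s \<ge> 1"
    using assms(1,2) by auto
  have "2 * s\<^sup>2 * (s - 1)\<^sup>2 \<le> 2 * s ^ s * (s - 1) ^ s"
    using assms(2) by (intro mult_le_mono power_increasing) auto
  then have "2 * s\<^sup>2 * (s - 1)\<^sup>2 \<le> m"
    using assms(3) by linarith
  then obtain K U where K: "L = Suc K" "A \<le> L" "A + (s - 1) * Suc K \<le> m" "m + s * (s - 1) * (U - 1) \<le> s * K"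
    and U: "(2 * real s - 3) * real m / (4 * real s ^ 2 * (real s - 1) ^ 2) \<le> real U"
    using parameters_exist[OF assms(2) _ A_def L_def] by blast
  define dig where "dig c \<longleftrightarrow> (\<forall>i j. c i j < b) \<and>
      (\<forall>i<s. \<forall>j\<ge>A. c i j = (if admissible_pos s m K i j then b - 1 else 0))" for c
  define \<Gamma> where "\<Gamma> = digit_point b s L ` Collect dig"
  have sub: "\<Gamma> \<subseteq> unit_cube s"
    unfolding \<Gamma>_def dig_def using digit_point_in_unit_cube[OF b(2)] by blast
  have dense: "\<exists>\<gamma>\<in>\<Gamma>. eucl_dist s x \<gamma> < real b * sqrt (real s) / real b powr (real m / (2 * (real s - 1) * real s))"
    if x: "x \<in> unit_cube s" for x
  proof -
    \<comment> \<open>The first \<open>A\<close> digits are those of \<open>x\<close>, the remaining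
      ones are the prescribed digits.\<close>
    define c where "c i j = (if j < A then nat \<lfloor>x i * real b ^ Suc j\<rfloor> mod b
        else if admissible_pos s m K i j then b - 1 else 0)" for i j
    have cb: "c i j < b" for i j
      using b by (simp add: c_def)
    then have "dig c"
      by (simp add: dig_def c_def)
    have "\<bar>x i - digit_point b s L c i\<bar> < 1 / real b ^ A" if "i < s" for i
      using trunc_digits_close[OF b(1), of "x i" "c i" A L] cb x that K(2)
      by (simp add: digit_point_def unit_cube_def c_def)
    then have "eucl_dist s x (digit_point b s L c) < sqrt (real s) * (1 / real b ^ A)"
      by (rule eucl_dist_less[OF s(1)])
    also have "\<dots> \<le> sqrt (real s) * (real b / real b powr (real m / real (2 * (s - 1) * s)))"
      unfolding A_def using assms(1,2) by (intro mult_left_mono inverse_power_div_le_powr) auto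
    also have "\<dots> = real b * sqrt (real s) / real b powr (real m / (2 * (real s - 1) * real s))"
      using assms(2) by (simp add: of_nat_diff)
    finally show ?thesis
      using \<open>dig c\<close> by (auto simp: \<Gamma>_def)
  qed
  have disc: "(real b - 1)^s * (2 * real s - 3)^(s-1) /
            (real b ^ s * (4 * real s^2 * (real s - 1)^2 * ln (real b))^(s-1))
          * ln (real (b^m))^(s-1) / real (b^m) \<le> star_disc s (b ^ m) P"
    if net: "is_net b m s P" and n: "n < b ^ m" "P n \<in> \<Gamma>" for P n
  proof -
    obtain c where c: "\<And>i j. c i j < b"
      "\<And>i j. i < s \<Longrightarrow> j \<ge> A \<Longrightarrow> c i j = (if admissible_pos s m K i j then b - 1 else 0)"
      and Pn: "P n = digit_point b s L c"
      using n(2) unfolding \<Gamma>_def dig_def by blast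
    let ?F = "PiE {..<s} (\<lambda>_. {..<L})"
    let ?G = "{J \<in> ?F. (\<Sum>i<s. J i) = m \<and> (\<forall>i<s. c i (J i) = b - 1)}"
    let ?\<beta> = "((real b - 1) / real b) ^ s"
    let ?q = "4 * real s ^ 2 * (real s - 1) ^ 2"
    have gap: "(\<Sum>i<s. J i) + s \<le> m \<or> m \<le> (\<Sum>i<s. J i)" if J: "J \<in> ?F" "\<forall>i<s. c i (J i) \<noteq> 0" for J
    proof (rule admissible_pos_gap[OF s(1) K(3)])
      show "J i \<le> K" if "i < s" for i
        using J(1) that K(1) by (auto simp: PiE_iff less_Suc_eq_le)
      \<comment> \<open>From position \<open>A\<close> on, nonzero digits stand at admissible
        positions only.\<close>
      show "admissible_pos s m K i (J i)" if "i < s" "A \<le> J i" for i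
        using J(2) that c(2)[OF that] by (auto split: if_splits)
    qed
    have "U ^ (s - 1) \<le> card {J \<in> ?F. (\<Sum>i<s. J i) = m \<and> (\<forall>i<s. A \<le> J i \<and> admissible_pos s m K i (J i))}"
      unfolding K(1) by (rule card_admissible_ge[OF assms(2) K(3,4)])
    also have "\<dots> \<le> card ?G"
    proof (rule card_mono)
      show "finite ?G"
        by (intro finite_subset[OF _ finite_PiE[of "{..<s}" "\<lambda>_. {..<L}"]]) auto
    qed (auto simp: c(2))
    finally have "real U ^ (s - 1) \<le> real (card ?G)"
      by (simp flip: of_nat_power)
    moreover have "((2 * real s - 3) * real m / ?q) ^ (s - 1) \<le> real U ^ (s - 1)"
      using assms(2) by (intro power_mono[OF U] divide_nonneg_nonneg mult_nonneg_nonneg) auto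
    ultimately have "?\<beta> * ((2 * real s - 3) * real m / ?q) ^ (s - 1) \<le> ?\<beta> * real (card ?G)"
      using b by (intro mult_left_mono[OF order_trans[rotated]]) auto
    also have "\<dots> \<le> \<bar>local_disc s (b ^ m) P (digit_point b s L c)\<bar>"
      using local_disc_digit_point_le[OF net b(2) s(2) c(1) n(1) Pn] gap by fastforce
    finally have "?\<beta> * ((2 * real s - 3) * real m / ?q) ^ (s - 1) / real (b ^ m) \<le>
        \<bar>local_disc s (b ^ m) P (digit_point b s L c)\<bar> / real (b ^ m)"
      by (rule divide_right_mono) simp
    also have "\<dots> \<le> star_disc s (b ^ m) P"
      by (rule star_disc_ge[OF digit_point_in_unit_cube[OF b(2) c(1)]])
    also have "?\<beta> * ((2 * real s - 3) * real m / ?q) ^ (s - 1) =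
        (real b - 1)^s * (2 * real s - 3)^(s-1) / (real b ^ s * (?q * ln (real b))^(s-1)) * ln (real (b^m))^(s-1)"
    proof -
      \<comment> \<open>Since \<open>ln (b ^ m) = m * ln b\<close>, the powers of
        \<open>ln b\<close> cancel once it is known to be nonzero.\<close>
      have "ln (real b) > 0"
        using assms(1) by simp
      then show ?thesis
        using b by (simp add: ln_realpow power_mult_distrib power_divide)
    qed
    finally show ?thesis .
  qed
  show ?thesis
    using sub dense disc by blast
qed

end
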